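(* Suppose that $f(z)=h(z)+\overline{g(z)}=\sum_{n=0}^\infty a_n z^n+\overline{\sum_{n=1}^\infty b_n z^n}$ is a sense-preserving $K$-quasiconformal harmonic mapping of the unit disk $\mathbb{D}$, where $h$ is a bounded function in $\mathbb{D}$. Then $$|a_0|^2+\sum_{n=1}^\infty (|a_n|+|b_n|)r^n\le \|h\|_\infty\quad\text{for } r\le \frac{K+1}{3K+1}.$$ The constant $(K+1)/(3K+1)$ is sharp.
   Context: $\mathbb{D}=\{z\in\mathbb{C}:|z|<1\}$, $\|h\|_\infty=\sup_{z\in\mathbb{D}}|h(z)|$, and $r\ge 0$ denotes a radius. A harmonic mapping in $\mathbb{D}$ is a complex-valued function $f$ with $\Delta f=0$; it is written $f=h+\overline{g}$ with $h,g$ analytic in $\mathbb{D}$ and $g(0)=0$, where $h(z)=\sum_{n\ge0}a_nz^n$ and $g(z)=\sum_{n\ge1}b_nz^n$. It is sense-preserving if its Jacobian $J_f=|h'|^2-|g'|^2$ is positive in $\mathbb{D}$; equivalently $h'\neq0$ and the dilatation $\omega_f=g'/h'$ satisfies $|\omega_f|<1$ in $\mathbb{D}$. A sense-preserving homeomorphism $f$ of $\mathbb{D}$ onto $\Omega'$, belonging to the Sobolev class $W^{1,2}_{loc}(\mathbb{D})$, is $K$-quasiconformal ($K\ge1$) if $\frac{|f_z|+|f_{\bar z}|}{|f_z|-|f_{\bar z}|}=\frac{1+|\omega_f(z)|}{1-|\omega_f(z)|}\le K$ for $z\in\mathbb{D}$, i.e. $|\omega_f(z)|\le k=\frac{K-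1}{K+1}$.
   Formalization: The formal theorem adds the normalization ‖h‖_∞ ≤ 1, since the inequality fails otherwise: f = h = 2 + z, g = 0 gives |a_0|² = 4 > 3 = ‖h‖_∞. Sharpness is shown with ‖h‖_∞ = 1. *)

theory Defs
  imports "HOL-Complex_Analysis.Complex_Analysis"
begin

abbreviation unit_disk :: "complex set" where
  "unit_disk \<equiv> ball 0 1"

definition sup_norm :: "(complex \<Rightarrow> complex) \<Rightarrow> real" where
  "sup_norm h = (SUP z\<in>unit_disk. norm (h z))"


subsection \<open>Real directional derivatives and Wirtinger derivatives\<close>

text \<open>The plane is the type \<^typ>\<open>complex\<close>; differentiability is over the reals, so that
  \<open>dir_deriv 1\<close> is the partial derivative in \<open>x\<close> and \<open>dir_deriv \<i>\<close> the one in \<open>y\<close>.\<close>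

definition dir_deriv ::
  "complex \<Rightarrow> (complex \<Rightarrow> 'b::real_normed_vector) \<Rightarrow> complex \<Rightarrow> 'b" where
  "dir_deriv v f z = frechet_derivative f (at z) v"

definition wirtinger_z :: "(complex \<Rightarrow> complex) \<Rightarrow> complex \<Rightarrow> complex" where
  "wirtinger_z f z = (dir_deriv 1 f z - \<i> * dir_deriv \<i> f z) / 2"

definition wirtinger_zbar :: "(complex \<Rightarrow> complex) \<Rightarrow> complex \<Rightarrow> complex" where
  "wirtinger_zbar f z = (dir_deriv 1 f z + \<i> * dir_deriv \<i> f z) / 2"


subsection \<open>Harmonic mappings\<close>

definition harmonic_mapping_on :: "complex set \<Rightarrow> (complex \<Rightarrow> complex) \<Rightarrow> bool" where
  "harmonic_mapping_on S f \<longleftrightarrow>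
     (\<forall>z\<in>S. f differentiable (at z)) \<and>
     (\<forall>v\<in>{1, \<i>}. \<forall>z\<in>S. dir_deriv v f differentiable (at z)) \<and>
     (\<forall>v\<in>{1, \<i>}. \<forall>w\<in>{1, \<i>}. continuous_on S (dir_deriv w (dir_deriv v f))) \<and>
     (\<forall>z\<in>S. dir_deriv 1 (dir_deriv 1 f) z + dir_deriv \<i> (dir_deriv \<i> f) z = 0)"

text \<open>The value \<open>b 0\<close> is not used: the series of \<open>g\<close> starts at index one.\<close>

definition canonical_representation ::
  "(complex \<Rightarrow> complex) \<Rightarrow> (complex \<Rightarrow> complex) \<Rightarrow> (complex \<Rightarrow> complex) \<Rightarrow>
   (nat \<Rightarrow> complex) \<Rightarrow> (nat \<Rightarrow> complex) \<Rightarrow> bool" where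
  "canonical_representation f h g a b \<longleftrightarrow>
     h holomorphic_on unit_disk \<and> g holomorphic_on unit_disk \<and> g 0 = 0 \<and>
     (\<forall>z\<in>unit_disk. f z = h z + cnj (g z)) \<and>
     (\<forall>z\<in>unit_disk. (\<lambda>n. a n * z ^ n) sums h z) \<and>
     (\<forall>z\<in>unit_disk. (\<lambda>n. b (Suc n) * z ^ Suc n) sums g z)"

text \<open>If \<open>f = h + cnj \<circ> g\<close> with \<open>h\<close>, \<open>g\<close> holomorphic, then \<open>wirtinger_z f = deriv h\<close> and
  \<open>wirtinger_zbar f = cnj \<circ> deriv g\<close>, so the Jacobian below is \<open>|h'|\<^sup>2 - |g'|\<^sup>2\<close>.\<close>

definition jacobian :: "(complex \<Rightarrow> complex) \<Rightarrow> complex \<Rightarrow> real" where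
  "jacobian f z = (norm (wirtinger_z f z))\<^sup>2 - (norm (wirtinger_zbar f z))\<^sup>2"

definition sense_preserving_on :: "complex set \<Rightarrow> (complex \<Rightarrow> complex) \<Rightarrow> bool" where
  "sense_preserving_on S f \<longleftrightarrow> (\<forall>z\<in>S. jacobian f z > 0)"


subsection \<open>The local Sobolev class\<close>

definition test_function_on :: "complex set \<Rightarrow> (complex \<Rightarrow> real) \<Rightarrow> bool" where
  "test_function_on S \<phi> \<longleftrightarrow>
     (\<forall>z. \<phi> differentiable (at z)) \<and>
     (\<forall>v\<in>{1, \<i>}. continuous_on UNIV (dir_deriv v \<phi>)) \<and>
     compact (closure {z. \<phi> z \<noteq> 0}) \<and> closure {z. \<phi> z \<noteq> 0} \<subseteq> S"

definition L2_loc :: "complex set \<Rightarrow> (complex \<Rightarrow> complex) \<Rightarrow> bool" where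
  "L2_loc S u \<longleftrightarrow>
     u \<in> borel_measurable (lebesgue_on S) \<and>
     (\<forall>C. compact C \<and> C \<subseteq> S \<longrightarrow> integrable (lebesgue_on C) (\<lambda>z. (norm (u z))\<^sup>2))"

definition weak_dir_deriv_on ::
  "complex set \<Rightarrow> complex \<Rightarrow> (complex \<Rightarrow> complex) \<Rightarrow> (complex \<Rightarrow> complex) \<Rightarrow> bool" where
  "weak_dir_deriv_on S v f u \<longleftrightarrow>
     (\<forall>\<phi>. test_function_on S \<phi> \<longrightarrow>
        (LINT z|lebesgue_on S. f z * of_real (dir_deriv v \<phi> z)) =
        - (LINT z|lebesgue_on S. u z * of_real (\<phi> z)))"

definition W12_loc :: "complex set \<Rightarrow> (complex \<Rightarrow> complex) \<Rightarrow> bool" where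
  "W12_loc S f \<longleftrightarrow> L2_loc S f \<and>
     (\<forall>v\<in>{1, \<i>}. \<exists>u. L2_loc S u \<and> weak_dir_deriv_on S v f u)"


subsection \<open>Quasiconformal harmonic mappings\<close>

text \<open>The distortion inequality is imposed pointwise with classical derivatives; this is the
  appropriate form for harmonic mappings, which are smooth. The denominator is positive because
  of the sense-preserving clause.\<close>

definition quasiconformal_harmonic :: "real \<Rightarrow> (complex \<Rightarrow> complex) \<Rightarrow> bool" where
  "quasiconformal_harmonic K f \<longleftrightarrow>
     harmonic_mapping_on unit_disk f \<and>
     sense_preserving_on unit_disk f \<and>
     (\<exists>\<Omega> f_inv. homeomorphism unit_disk \<Omega> f f_inv) \<and>
     W12_loc unit_disk f \<and>
     (\<forall>z\<in>unit_disk.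
        (norm (wirtinger_z f z) + norm (wirtinger_zbar f z)) /
        (norm (wirtinger_z f z) - norm (wirtinger_zbar f z)) \<le> K)"


subsection \<open>The Bohr-type sum\<close>

text \<open>The majorant is quadratic in the constant term and linear in the others, hence not
  homogeneous. An estimate by \<^term>\<open>sup_norm h\<close> therefore presupposes the normalization
  \<^prop>\<open>sup_norm h \<le> 1\<close>: for \<open>f z = h z = 2 + z\<close>, already the constant term contributes
  \<open>4 > 3 = sup_norm h\<close>.\<close>

definition bohr_terms :: "(nat \<Rightarrow> complex) \<Rightarrow> (nat \<Rightarrow> complex) \<Rightarrow> real \<Rightarrow> nat \<Rightarrow> real" where
  "bohr_terms a b r n = (norm (a (Suc n)) + norm (b (Suc n))) * r ^ Suc n"

definition bohr_sum :: "(nat \<Rightarrow> complex) \<Rightarrow> (nat \<Rightarrow> complex) \<Rightarrow> real \<Rightarrow> real" where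
  "bohr_sum a b r = (norm (a 0))\<^sup>2 + (\<Sum>n. bohr_terms a b r n)"

end

theory Submission
  imports Defs
begin

text \<open>
  Put \<open>k = (K - 1) / (K + 1)\<close>. Quasiconformality says \<open>|g'| \<le> k * |h'|\<close>, and the radius
  \<open>(K + 1) / (3 * K + 1)\<close> equals \<open>1 / (2 + k)\<close>.

  Two facts carry the inequality. First, a function bounded by \<open>M\<close> has Taylor coefficients with
  \<open>M * |a n| \<le> M\<^sup>2 - |a 0|\<^sup>2\<close> for \<open>n \<ge> 1\<close> (\<open>bounded_function_coefficient_bound\<close>). Secondly, \<open>|g'| \<le> k * |h'|\<close> forces
  \<open>\<Sum> |b n|\<^sup>2 * r ^ n \<le> k\<^sup>2 * \<Sum> |a n|\<^sup>2 * r ^ n\<close> over \<open>n \<ge> 1\<close>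
  (\<open>sum_norm_square_coeffs_le_if_derivative_dominated\<close>). Both
  come from one principle, \<open>sum_norm_square_le_if_dominated_on_circle\<close>: by Parseval, a pointwise
  majorization on a circle passes to the square-sums of the coefficients. Put
  \<open>A = (M\<^sup>2 - |a 0|\<^sup>2) / M\<close>. Cauchy-Schwarz bounds \<open>\<Sum> |b n| * r ^ n\<close> by
  \<open>k * A * r / (1 - r)\<close>, just as a geometric series bounds
  \<open>\<Sum> |a n| * r ^ n\<close> by \<open>A * r / (1 - r)\<close>. Together they are at most \<open>A\<close> if \<open>r \<le> 1 / (2 + k)\<close>, and
  \<open>|a 0|\<^sup>2 + A \<le> M\<close> because \<open>M \<le> 1\<close>.

  For sharpness, take a disk automorphism \<open>h\<close> with zero \<open>t\<close>, and
  \<open>g = k * (h - h 0)\<close>. The sum is then explicit, and for \<open>r > 1 / (2 + k)\<close> it exceeds \<open>1\<close> once \<open>t\<close> is close enough to \<open>1\<close>. It remains to see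
  that this mapping is quasiconformal in the full sense of the definition. It is injective and continuous,
  hence a homeomorphism onto its image by invariance of domain, and it is of class \<open>C\<^sup>1\<close>, hence
  locally Sobolev (\<open>W12_loc_C1\<close>).
\<close>

section \<open>Square-sums of coefficients and majorization on circles\<close>

text \<open>Discrete Parseval: averaging over the \<open>N\<close>-th roots of unity kills every cross term
  \<open>c n * cnj (c m)\<close> with \<open>n \<noteq> m\<close>, because \<open>\<zeta> ^ n * cnj (\<zeta> ^ m)\<close> is then a nontrivial
  \<open>N\<close>-th root of unity, whose powers form a geometric sum equal to zero. A polynomial of degree
  below \<open>N\<close> needs no integral over the circle.\<close>

lemma average_norm_square_roots_of_unity:
  fixes c :: "nat \<Rightarrow> complex"
  assumes "N > 0"
  defines "\<zeta> \<equiv> exp (2 * of_real pi * \<i> / of_nat N)"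
  shows "(\<Sum>j<N. (norm (\<Sum>n<N. c n * (\<zeta> ^ j) ^ n))\<^sup>2) = of_nat N * (\<Sum>n<N. (norm (c n))\<^sup>2)"
proof -
  have \<zeta>: "norm \<zeta> = 1" by (simp add: \<zeta>_def norm_exp_i_times[of "2*pi/N"] field_simps)
  hence \<zeta>1: "\<zeta> * cnj \<zeta> = 1" by (metis complex_norm_square norm_one of_real_1 one_power2)
  have pow: "\<zeta> ^ n = exp (2 * of_real pi * \<i> * of_nat n / of_nat N)" for n
    unfolding \<zeta>_def exp_of_nat_mult[symmetric] by (simp add: field_simps)
  have \<zeta>N: "\<zeta> ^ N = 1"
    using assms(1) exp_two_pi_i by (simp add: pow field_simps)
  have inj: "n = m" if "\<zeta> ^ n = \<zeta> ^ m" "n < N" "m < N" for n m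
    using that assms(1) complex_root_unity_eq[of N n m] by (simp add: pow cong_def)
  have orth: "(\<Sum>j<N. (\<zeta> ^ j) ^ n * cnj ((\<zeta> ^ j) ^ m)) = (if n = m then of_nat N else 0)"
    if "n < N" "m < N" for n m
  proof -
    let ?w = "\<zeta> ^ n * cnj (\<zeta> ^ m)"
    have "(\<zeta> ^ j) ^ n * cnj ((\<zeta> ^ j) ^ m) = ?w ^ j" for j
      by (simp add: power_mult_distrib mult.commute flip: power_mult)
    hence sm: "(\<Sum>j<N. (\<zeta> ^ j) ^ n * cnj ((\<zeta> ^ j) ^ m)) = (\<Sum>j<N. ?w ^ j)" by simp
    have unit: "\<zeta> ^ k * cnj (\<zeta> ^ k) = 1" for k
      using \<zeta>1 by (metis complex_cnj_power power_mult_distrib power_one)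
    show ?thesis
    proof (cases "n = m")
      case True thus ?thesis using sm unit[of m] by simp
    next
      case False
      have "?w \<noteq> 1"
      proof
        assume "?w = 1"
        have "\<zeta> ^ n = \<zeta> ^ n * (\<zeta> ^ m * cnj (\<zeta> ^ m))" by (simp only: unit mult_1_right)
        also have "\<dots> = ?w * \<zeta> ^ m" by (simp only: mult_ac)
        finally have "\<zeta> ^ n = \<zeta> ^ m" using \<open>?w = 1\<close> by (simp only: mult_1)
        with False inj that show False by blast
      qed
      moreover have "?w ^ N = (\<zeta> ^ N) ^ n * cnj ((\<zeta> ^ N) ^ m)"
        by (simp add: power_mult_distrib mult.commute flip: power_mult)
      hence "?w ^ N = 1" using \<zeta>N by simp
      ultimately show ?thesis using sm False by (simp add: geometric_sum)
    qed
  qed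
  have "complex_of_real (\<Sum>j<N. (norm (\<Sum>n<N. c n * (\<zeta> ^ j) ^ n))\<^sup>2)
    = (\<Sum>j<N. (\<Sum>n<N. c n * (\<zeta> ^ j) ^ n) * cnj (\<Sum>n<N. c n * (\<zeta> ^ j) ^ n))"
    unfolding of_real_sum by (rule sum.cong) (simp_all only: complex_norm_square of_real_power[symmetric])
  also have "\<dots> = (\<Sum>j<N. \<Sum>n<N. \<Sum>m<N. c n * cnj (c m) * ((\<zeta> ^ j) ^ n * cnj ((\<zeta> ^ j) ^ m)))"
    by (simp add: sum_product mult_ac)
  also have "\<dots> = (\<Sum>n<N. \<Sum>m<N. \<Sum>j<N. c n * cnj (c m) * ((\<zeta> ^ j) ^ n * cnj ((\<zeta> ^ j) ^ m)))"
    by (subst sum.swap, rule sum.cong[OF refl], rule sum.swap)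
  also have "\<dots> = (\<Sum>n<N. \<Sum>m<N. c n * cnj (c m) * (if n = m then of_nat N else 0))"
    using orth by (simp flip: sum_distrib_left)
  also have "\<dots> = (\<Sum>n<N. of_nat N * (c n * cnj (c n)))"
    by (rule sum.cong) (simp_all add: if_distrib[of "\<lambda>x. _ * x"] mult_ac cong: if_cong)
  also have "\<dots> = complex_of_real (of_nat N * (\<Sum>n<N. (norm (c n))\<^sup>2))"
    by (simp add: sum_distrib_left complex_norm_square flip: of_real_power)
  finally show ?thesis by (simp only: of_real_eq_iff)
qed

lemma summable_power2:
  fixes f :: "nat \<Rightarrow> real"
  assumes "summable (\<lambda>n. \<bar>f n\<bar>)"
  shows "summable (\<lambda>n. (f n)\<^sup>2)"
proof (rule summable_comparison_test_ev[OF _ assms])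
  have "(\<lambda>n. \<bar>f n\<bar>) \<longlonglongrightarrow> 0" using assms by (rule summable_LIMSEQ_zero)
  hence "\<forall>\<^sub>F n in sequentially. \<bar>f n\<bar> < 1" by (rule order_tendstoD) simp
  thus "\<forall>\<^sub>F n in sequentially. norm ((f n)\<^sup>2) \<le> \<bar>f n\<bar>"
  proof eventually_elim
    case (elim n)
    hence "\<bar>f n\<bar> * \<bar>f n\<bar> \<le> \<bar>f n\<bar> * 1" by (intro mult_left_mono) auto
    thus ?case by (simp add: power2_eq_square abs_mult)
  qed
qed

text \<open>Parseval turns a pointwise majorization on the circle into a majorization of the
  \<open>\<ell>\<^sup>2\<close> norms of the coefficients. The series are absolutely convergent on the circle, so their
  partial sums satisfy the pointwise inequality of squares up to an error that tends to zero
  uniformly. The discrete Parseval identity applies to the partial sums.\<close>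

lemma sum_norm_square_le_if_dominated_on_circle:
  fixes p q :: "nat \<Rightarrow> complex"
  assumes p: "summable (\<lambda>n. norm (p n))" and q: "summable (\<lambda>n. norm (q n))" and "k \<ge> 0"
    and dom: "\<And>z. norm z = 1 \<Longrightarrow> norm (\<Sum>n. p n * z ^ n) \<le> k * norm (\<Sum>n. q n * z ^ n)"
  shows "(\<Sum>n. (norm (p n))\<^sup>2) \<le> k\<^sup>2 * (\<Sum>n. (norm (q n))\<^sup>2)"
proof -
  \<comment> \<open>The error \<open>\<delta> N\<close> is what the two tails add to \<open>|P| \<le> k * |Q|\<close>, and \<open>B\<close> bounds every partial sum of \<open>q\<close>.\<close>
  define \<delta> where "\<delta> N = k * (\<Sum>n. norm (q (n + N))) + (\<Sum>n. norm (p (n + N)))" for N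
  define B where "B = (\<Sum>n. norm (q n))"
  have tail: "norm ((\<Sum>n. s n * z ^ n) - (\<Sum>n<N. s n * z ^ n)) \<le> (\<Sum>n. norm (s (n + N)))"
    if s: "summable (\<lambda>n. norm (s n))" and z: "norm z = 1" for s :: "nat \<Rightarrow> complex" and z N
  proof -
    have 1: "summable (\<lambda>n. norm (s n * z ^ n))" using s z by (simp add: norm_mult norm_power)
    have 2: "summable (\<lambda>n. norm (s (n + N) * z ^ (n + N)))"
      using 1 by (subst summable_iff_shift)
    have "(\<Sum>n. s n * z ^ n) - (\<Sum>n<N. s n * z ^ n) = (\<Sum>n. s (n + N) * z ^ (n + N))"
      using suminf_split_initial_segment[OF summable_norm_cancel[OF 1], of N] by simp
    also have "norm \<dots> \<le> (\<Sum>n. norm (s (n + N) * z ^ (n + N)))" by (rule summable_norm[OF 2])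
    finally show ?thesis using z by (simp add: norm_mult norm_power)
  qed
  have pt: "(norm (\<Sum>n<N. p n * z ^ n))\<^sup>2
      \<le> k\<^sup>2 * (norm (\<Sum>n<N. q n * z ^ n))\<^sup>2 + (2 * k * B * \<delta> N + (\<delta> N)\<^sup>2)"
    if z: "norm z = 1" for z N
  proof -
    let ?P = "\<Sum>n<N. p n * z ^ n" and ?Q = "\<Sum>n<N. q n * z ^ n"
    let ?P' = "\<Sum>n. p n * z ^ n" and ?Q' = "\<Sum>n. q n * z ^ n"
    have "norm ?Q \<le> (\<Sum>n<N. norm (q n))"
      using z by (intro sum_norm_le) (simp add: norm_mult norm_power)
    also have "\<dots> \<le> B" unfolding B_def using q by (intro sum_le_suminf) auto
    finally have QB: "norm ?Q \<le> B" .
    have d0: "\<delta> N \<ge> 0" unfolding \<delta>_def using \<open>k \<ge> 0\<close> p q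
      by (intro add_nonneg_nonneg mult_nonneg_nonneg suminf_nonneg) (auto intro: summable_ignore_initial_segment)
    have "norm ?P \<le> norm ?P' + norm (?P' - ?P)"
      using norm_triangle_sub[of ?P ?P'] by (simp add: norm_minus_commute)
    moreover have "norm ?Q' \<le> norm ?Q + norm (?Q' - ?Q)" by (rule norm_triangle_sub)
    ultimately have "norm ?P \<le> k * (norm ?Q + (\<Sum>n. norm (q (n + N)))) + (\<Sum>n. norm (p (n + N)))"
      using tail[OF p z, of N] tail[OF q z, of N] dom[OF z] mult_left_mono[OF _ \<open>k \<ge> 0\<close>,
        of "norm ?Q'" "norm ?Q + (\<Sum>n. norm (q (n + N)))"] by linarith
    hence "norm ?P \<le> k * norm ?Q + \<delta> N" by (simp add: \<delta>_def algebra_simps)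
    hence "(norm ?P)\<^sup>2 \<le> (k * norm ?Q + \<delta> N)\<^sup>2" by (intro power_mono) auto
    also have "\<dots> = k\<^sup>2 * (norm ?Q)\<^sup>2 + (2 * k * \<delta> N * norm ?Q + (\<delta> N)\<^sup>2)"
      by (simp add: power2_eq_square algebra_simps)
    also have "2 * k * \<delta> N * norm ?Q \<le> 2 * k * \<delta> N * B"
      using QB d0 \<open>k \<ge> 0\<close> by (intro mult_left_mono) auto
    finally show ?thesis by (simp add: mult_ac)
  qed
  have fin: "(\<Sum>n<N. (norm (p n))\<^sup>2)
      \<le> k\<^sup>2 * (\<Sum>n<N. (norm (q n))\<^sup>2) + (2 * k * B * \<delta> N + (\<delta> N)\<^sup>2)" if N: "N > 0" for N
  proof -
    let ?\<zeta> = "exp (2 * of_real pi * \<i> / of_nat N)"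
    have n1: "norm (?\<zeta> ^ j) = 1" for j
      by (simp add: norm_power norm_exp_i_times[of "2*pi/N"] field_simps)
    have "real N * (\<Sum>n<N. (norm (p n))\<^sup>2)
      \<le> (\<Sum>j<N. k\<^sup>2 * (norm (\<Sum>n<N. q n * (?\<zeta> ^ j) ^ n))\<^sup>2 + (2 * k * B * \<delta> N + (\<delta> N)\<^sup>2))"
      unfolding average_norm_square_roots_of_unity[OF N, symmetric] by (intro sum_mono pt n1)
    also have "\<dots> = real N * (k\<^sup>2 * (\<Sum>n<N. (norm (q n))\<^sup>2) + (2 * k * B * \<delta> N + (\<delta> N)\<^sup>2))"
      unfolding sum.distrib sum_distrib_left[symmetric] average_norm_square_roots_of_unity[OF N]
      by (simp add: algebra_simps)
    finally show ?thesis using N by simp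
  qed
  have "\<delta> \<longlonglongrightarrow> k * 0 + 0" unfolding \<delta>_def
    by (intro tendsto_intros suminf_exist_split2 p q)
  hence lim\<delta>: "\<delta> \<longlonglongrightarrow> 0" by simp
  have sp: "(\<lambda>N. \<Sum>n<N. (norm (p n))\<^sup>2) \<longlonglongrightarrow> (\<Sum>n. (norm (p n))\<^sup>2)"
    and sq: "(\<lambda>N. \<Sum>n<N. (norm (q n))\<^sup>2) \<longlonglongrightarrow> (\<Sum>n. (norm (q n))\<^sup>2)"
    using p q by (auto intro!: summable_LIMSEQ summable_power2)
  have "(\<lambda>N. k\<^sup>2 * (\<Sum>n<N. (norm (q n))\<^sup>2) + (2 * k * B * \<delta> N + (\<delta> N)\<^sup>2))
      \<longlonglongrightarrow> k\<^sup>2 * (\<Sum>n. (norm (q n))\<^sup>2) + (2 * k * B * 0 + 0\<^sup>2)"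
    by (intro tendsto_intros sq lim\<delta>)
  moreover have "\<forall>\<^sub>F N in sequentially. (\<Sum>n<N. (norm (p n))\<^sup>2)
      \<le> k\<^sup>2 * (\<Sum>n<N. (norm (q n))\<^sup>2) + (2 * k * B * \<delta> N + (\<delta> N)\<^sup>2)"
    using eventually_gt_at_top[of 0] by (rule eventually_mono) (rule fin)
  ultimately have "(\<Sum>n. (norm (p n))\<^sup>2) \<le> k\<^sup>2 * (\<Sum>n. (norm (q n))\<^sup>2) + (2 * k * B * 0 + 0\<^sup>2)"
    by (intro tendsto_le[OF sequentially_bot _ sp])
  thus ?thesis by simp
qed

section \<open>Coefficients of bounded functions\<close>

text \<open>The classical estimate \<open>|a n| \<le> 1 - |a 0|\<^sup>2\<close>, scaled to the bound \<open>M\<close>. Multiplication by \<open>h\<close>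
  is an operator of norm at most \<open>M\<close> on square-summable power series. Its effect on
  \<open>1 + y * z ^ n\<close>, seen only in the degrees \<open>0\<close> and \<open>n\<close>, gives an inequality valid for all \<open>y\<close>,
  and the best \<open>y\<close> yields the claim.\<close>

lemma bounded_function_coefficient_bound:
  fixes h :: "complex \<Rightarrow> complex"
  assumes sums: "\<And>z. norm z < 1 \<Longrightarrow> (\<lambda>n. a n * z ^ n) sums h z"
    and bd: "\<And>z. norm z < 1 \<Longrightarrow> norm (h z) \<le> M" and "n \<noteq> 0"
  shows "M * norm (a n) \<le> M\<^sup>2 - (norm (a 0))\<^sup>2"
proof -
  have M0: "M \<ge> 0" by (rule order_trans[OF norm_ge_zero bd[of 0]]) simp
  have "a 0 = h 0" using sums_unique2[OF powser_sums_zero sums[of 0]] by simp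
  hence a0M: "norm (a 0) \<le> M" using bd[of 0] by simp
  define A where "A = M\<^sup>2 - (norm (a 0))\<^sup>2"
  have A0: "A \<ge> 0" unfolding A_def using a0M by (simp add: power_mono)
  \<comment> \<open>On the circle of radius \<open>\<rho>\<close> the series converges absolutely; the limit \<open>\<rho> \<rightarrow> 1\<close> is taken at the end.\<close>
  have key: "(norm (a 0))\<^sup>2 + (norm (a n * of_real \<rho> ^ n + a 0 * y))\<^sup>2 \<le> M\<^sup>2 * (1 + (norm y)\<^sup>2)"
    if \<rho>: "0 \<le> \<rho>" "\<rho> < 1" for \<rho> y
  proof -
    define s where "s m = a m * of_real \<rho> ^ m" for m
    define t where "t m = (if m < n then 0 else s (m - n) * y)" for m
    define p where "p m = s m + t m" for m
    define q where "q m = (if m = 0 then 1 else if m = n then y else 0)" for m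
    obtain \<sigma> where \<sigma>: "\<rho> < \<sigma>" "\<sigma> < 1" using dense \<rho> by blast
    have "summable (\<lambda>m. norm (a m * (of_real \<rho>) ^ m))"
      by (rule powser_insidea[of a "of_real \<sigma>"]) (use \<sigma> \<rho> sums[of "of_real \<sigma>"] in \<open>auto simp: sums_iff\<close>)
    hence ss: "summable (\<lambda>m. norm (s m))" by (simp add: s_def)
    have "summable (\<lambda>m. norm (s m) * norm y)" using ss by (rule summable_mult2)
    hence st: "summable (\<lambda>m. norm (t m))"
      by (subst summable_iff_shift[symmetric, of _ n]) (simp add: t_def norm_mult)
    have sp: "summable (\<lambda>m. norm (p m))"
      unfolding p_def by (rule summable_comparison_test_ev[OF _ summable_add[OF ss st]])
        (simp add: norm_triangle_ineq)
    have sq: "summable (\<lambda>m. norm (q m))"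
      by (rule summable_finite[of "{0,n}"]) (auto simp: q_def)
    have q_sum: "(\<Sum>m. q m * z ^ m) = 1 + y * z ^ n" for z
      using \<open>n \<noteq> 0\<close> by (subst suminf_finite[of "{0,n}"]) (auto simp: q_def)
    have q_sq: "(\<Sum>m. (norm (q m))\<^sup>2) = 1 + (norm y)\<^sup>2"
      using \<open>n \<noteq> 0\<close> by (subst suminf_finite[of "{0,n}"]) (auto simp: q_def)
    have p_sum: "(\<Sum>m. p m * z ^ m) = h (of_real \<rho> * z) * (1 + y * z ^ n)" if z: "norm z = 1" for z
    proof -
      have 1: "(\<lambda>m. s m * z ^ m) sums h (of_real \<rho> * z)"
        using sums[of "of_real \<rho> * z"] \<rho> z by (simp add: s_def norm_mult power_mult_distrib mult_ac)
      from sums_mult2[OF this, of "y * z ^ n"]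
      have "(\<lambda>m. t (m + n) * z ^ (m + n)) sums (h (of_real \<rho> * z) * (y * z ^ n))"
        by (simp add: t_def power_add mult_ac)
      hence 2: "(\<lambda>m. t m * z ^ m) sums (h (of_real \<rho> * z) * (y * z ^ n))"
        by (subst (asm) sums_iff_shift) (simp add: t_def)
      from sums_add[OF 1 2] show ?thesis
        by (simp add: p_def algebra_simps sums_iff)
    qed
    have dom: "norm (\<Sum>m. p m * z ^ m) \<le> M * norm (\<Sum>m. q m * z ^ m)" if "norm z = 1" for z
      unfolding p_sum[OF that] q_sum norm_mult
      using bd[of "of_real \<rho> * z"] that \<rho> by (intro mult_right_mono) (auto simp: norm_mult)
    have "(norm (a 0))\<^sup>2 + (norm (a n * of_real \<rho> ^ n + a 0 * y))\<^sup>2 = (\<Sum>m\<in>{0,n}. (norm (p m))\<^sup>2)"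
      using \<open>n \<noteq> 0\<close> by (simp add: p_def t_def s_def)
    also have "\<dots> \<le> (\<Sum>m. (norm (p m))\<^sup>2)"
      using summable_power2[of "\<lambda>m. norm (p m)"] sp by (intro sum_le_suminf) auto
    also have "\<dots> \<le> M\<^sup>2 * (\<Sum>m. (norm (q m))\<^sup>2)"
      by (rule sum_norm_square_le_if_dominated_on_circle[OF sp sq M0 dom])
    finally show ?thesis by (simp add: q_sq)
  qed
  have bound: "M * norm (a n * of_real \<rho> ^ n) \<le> A" if \<rho>: "0 \<le> \<rho>" "\<rho> < 1" for \<rho>
  proof -
    let ?\<alpha> = "norm (a 0)" and ?b = "a n * of_real \<rho> ^ n"
    define \<beta> where "\<beta> = norm ?b"
    \<comment> \<open>The factor \<open>b * cnj (a 0)\<close> in \<open>y\<close> makes \<open>a 0 * y\<close> point in the direction of \<open>b\<close>, so that norms add.\<close>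
    have main: "?\<alpha>\<^sup>2 + (\<beta> * (1 + ?\<alpha>\<^sup>2 * s))\<^sup>2 \<le> M\<^sup>2 * (1 + (\<beta> * ?\<alpha> * s)\<^sup>2)" if "s \<ge> 0" for s
    proof -
      have "?b + a 0 * (?b * cnj (a 0) * of_real s) = ?b * (1 + a 0 * cnj (a 0) * of_real s)"
        by (simp add: algebra_simps)
      also have "\<dots> = ?b * of_real (1 + ?\<alpha>\<^sup>2 * s)"
        by (simp only: complex_norm_square[symmetric] of_real_add of_real_mult of_real_1)
      finally have "norm (?b + a 0 * (?b * cnj (a 0) * of_real s)) = \<beta> * (1 + ?\<alpha>\<^sup>2 * s)"
        using that by (simp only: norm_mult \<beta>_def norm_of_real) simp
      moreover have "norm (?b * cnj (a 0) * of_real s) = \<beta> * ?\<alpha> * s"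
        using that by (simp add: norm_mult \<beta>_def)
      ultimately show ?thesis using key[OF \<rho>, of "?b * cnj (a 0) * of_real s"] by simp
    qed
    have "(M * \<beta>)\<^sup>2 \<le> A\<^sup>2"
    proof (cases "A = 0")
      case True
      hence "M\<^sup>2 = ?\<alpha>\<^sup>2" by (simp add: A_def)
      with main[of 0] show ?thesis by simp
    next
      case False
      with A0 have Ap: "A > 0" by simp
      have M2: "M\<^sup>2 = A + ?\<alpha>\<^sup>2" by (simp add: A_def)
      \<comment> \<open>The choice \<open>s = 1 / A\<close> minimizes the difference of the two sides, a quadratic in \<open>s\<close>.\<close>
      define x where "x = ?\<alpha>\<^sup>2 / A"
      have \<alpha>: "?\<alpha>\<^sup>2 = A * x" using Ap by (simp add: x_def)
      have "(\<beta> * ?\<alpha> * (1/A))\<^sup>2 = \<beta>\<^sup>2 * x / A"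
        using Ap by (simp add: power_mult_distrib power_divide \<alpha>) (simp add: power2_eq_square)
      moreover have "?\<alpha>\<^sup>2 * (1/A) = x" by (simp add: x_def)
      ultimately have "A * x + (\<beta> * (1 + x))\<^sup>2 \<le> (A + A * x) * (1 + \<beta>\<^sup>2 * x / A)"
        using main[of "1/A"] A0 unfolding M2 \<alpha> by simp
      also have "\<dots> = A + A * x + \<beta>\<^sup>2 * x * (1 + x)" using Ap by (simp add: field_simps)
      finally have "\<beta>\<^sup>2 * (1 + x) \<le> A" by (simp add: power2_eq_square algebra_simps)
      hence "A * (\<beta>\<^sup>2 * (1 + x)) \<le> A * A" using Ap by (intro mult_left_mono) auto
      thus ?thesis by (simp add: M2 \<alpha> power_mult_distrib power2_eq_square[of A] algebra_simps)
    qed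
    from power2_le_imp_le[OF this A0] show ?thesis by (simp only: \<beta>_def)
  qed
  have "((\<lambda>\<rho>. M * norm (a n * of_real \<rho> ^ n)) \<longlongrightarrow> M * norm (a n * of_real 1 ^ n)) (at_left 1)"
    by (intro tendsto_intros)
  moreover have "\<forall>\<^sub>F \<rho> in at_left (1::real). M * norm (a n * of_real \<rho> ^ n) \<le> A"
    using eventually_at_left_real[OF zero_less_one] by (rule eventually_mono) (use bound in auto)
  ultimately have "M * norm (a n * of_real 1 ^ n) \<le> A"
    by (rule tendsto_upperbound) simp
  thus ?thesis by (simp add: A_def)
qed

section \<open>Coefficients under majorization of derivatives\<close>

text \<open>The factor \<open>Suc n\<close> is removed by integration: the weighted sum is the derivative of
  \<open>x * (\<Sum>n. d n * x ^ n)\<close>, which vanishes at \<open>0\<close>.\<close>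

lemma powser_nonneg_if_weighted_nonneg:
  fixes d :: "nat \<Rightarrow> real"
  assumes sm: "\<And>x. \<bar>x\<bar> < 1 \<Longrightarrow> summable (\<lambda>n. d n * x ^ n)"
    and nn: "\<And>x. 0 \<le> x \<Longrightarrow> x < 1 \<Longrightarrow> 0 \<le> (\<Sum>n. real (Suc n) * d n * x ^ n)"
    and x: "0 \<le> x" "x < 1"
  shows "0 \<le> (\<Sum>n. d n * x ^ n)"
proof (cases "x = 0")
  case True
  with nn[of 0] show ?thesis by (simp add: powser_zero)
next
  case False
  define c where "c n = (case n of 0 \<Rightarrow> 0 | Suc m \<Rightarrow> d m)" for n
  define P where "P x = (\<Sum>n. c n * x ^ n)" for x :: real
  have smc: "summable (\<lambda>n. c n * x ^ n)" if "norm x < 1" for x :: real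
    using sm[of x] that summable_powser_split_head[of c x] by (simp add: c_def)
  have P: "P x = (\<Sum>n. d n * x ^ n) * x" if "norm x < 1" for x :: real
    using powser_split_head(1)[OF smc[OF that]] by (simp add: P_def c_def)
  have "P 0 \<le> P x"
  proof (rule DERIV_nonneg_imp_nondecreasing[OF x(1)])
    fix t assume t: "0 \<le> t" "t \<le> x"
    have "(P has_field_derivative (\<Sum>n. diffs c n * t ^ n)) (at t)"
      unfolding P_def by (rule termdiffs_strong'[of 1]) (use smc t x in auto)
    moreover have "diffs c n = real (Suc n) * d n" for n by (simp add: diffs_def c_def)
    ultimately show "\<exists>y. (P has_real_derivative y) (at t) \<and> 0 \<le> y" using nn[of t] t x by auto
  qed
  hence "0 \<le> (\<Sum>n. d n * x ^ n) * x" using P[of 0] P[of x] x by simp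
  with False x show ?thesis by (simp add: zero_le_mult_iff)
qed

lemma summable_norm_square_powser:
  fixes c :: "nat \<Rightarrow> complex" and x :: real
  assumes "\<And>z. norm z < 1 \<Longrightarrow> summable (\<lambda>n. c n * z ^ n)" and "\<bar>x\<bar> < 1"
  shows "summable (\<lambda>n. norm (c n * of_real (sqrt \<bar>x\<bar>) ^ n))"
    and "summable (\<lambda>n. (norm (c n))\<^sup>2 * x ^ n)"
proof -
  have s: "sqrt \<bar>x\<bar> < 1" using assms(2) by simp
  then obtain \<sigma> where \<sigma>: "sqrt \<bar>x\<bar> < \<sigma>" "\<sigma> < 1" using dense by blast
  moreover have "0 \<le> sqrt \<bar>x\<bar>" by simp
  ultimately have "0 \<le> \<sigma>" by linarith
  show 1: "summable (\<lambda>n. norm (c n * of_real (sqrt \<bar>x\<bar>) ^ n))"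
    by (rule powser_insidea[of c "of_real \<sigma>"]) (use \<sigma> \<open>0 \<le> \<sigma>\<close> assms(1)[of "of_real \<sigma>"] in auto)
  have "(sqrt \<bar>x\<bar> ^ n)\<^sup>2 = \<bar>x\<bar> ^ n" for n
    by (metis abs_ge_zero power_mult mult.commute real_sqrt_pow2)
  with summable_power2[of "\<lambda>n. norm (c n * of_real (sqrt \<bar>x\<bar>) ^ n)"] 1
  have "summable (\<lambda>n. norm ((norm (c n))\<^sup>2 * x ^ n))"
    by (simp add: norm_mult norm_power power_mult_distrib abs_mult power_abs)
  thus "summable (\<lambda>n. (norm (c n))\<^sup>2 * x ^ n)" by (rule summable_norm_cancel)
qed

text \<open>Parseval on the circle of radius \<open>sqrt x\<close> compares \<open>\<Sum>n. (Suc n)\<^sup>2 * |b (Suc n)|\<^sup>2 * x ^ n\<close>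
  with its counterpart for \<open>a\<close>. Removing the weight \<open>Suc n\<close> twice leaves the sums without weights.\<close>

lemma sum_norm_square_coeffs_le_if_derivative_dominated:
  fixes a b :: "nat \<Rightarrow> complex"
  assumes a: "\<And>z. norm z < 1 \<Longrightarrow> summable (\<lambda>n. a n * z ^ n)"
    and b: "\<And>z. norm z < 1 \<Longrightarrow> summable (\<lambda>n. b n * z ^ n)" and k: "k \<ge> 0"
    and dom: "\<And>z. norm z < 1 \<Longrightarrow>
      norm (\<Sum>n. diffs b n * z ^ n) \<le> k * norm (\<Sum>n. diffs a n * z ^ n)"
    and x: "0 \<le> x" "x < 1"
  shows "(\<Sum>n. (norm (b (Suc n)))\<^sup>2 * x ^ n) \<le> k\<^sup>2 * (\<Sum>n. (norm (a (Suc n)))\<^sup>2 * x ^ n)"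
proof -
  define d where "d n = k\<^sup>2 * (norm (a (Suc n)))\<^sup>2 - (norm (b (Suc n)))\<^sup>2" for n
  have shift: "summable (\<lambda>n. (norm (c (Suc n)))\<^sup>2 * t ^ n)"
    if "\<And>z. norm z < 1 \<Longrightarrow> summable (\<lambda>n. c n * z ^ n)" "\<bar>t\<bar> < 1" for c :: "nat \<Rightarrow> complex" and t :: real
    by (rule summable_norm_square_powser(2)) (use that summable_powser_split_head in blast)+
  have diff: "summable (\<lambda>n. diffs c n * z ^ n)"
    if "\<And>z. norm z < 1 \<Longrightarrow> summable (\<lambda>n. c n * z ^ n)" "norm z < 1" for c :: "nat \<Rightarrow> complex" and z
    using that termdiff_converges by blast
  have norm_diffs: "(norm (diffs c n))\<^sup>2 = real (Suc n) * (real (Suc n) * (norm (c (Suc n)))\<^sup>2)"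
    for c :: "nat \<Rightarrow> complex" and n
    by (simp only: diffs_def norm_mult norm_of_nat power2_eq_square mult_ac)
  have weighted: "summable (\<lambda>n. real (Suc n) * (norm (c (Suc n)))\<^sup>2 * t ^ n)"
    if c: "\<And>z. norm z < 1 \<Longrightarrow> summable (\<lambda>n. c n * z ^ n)" and t: "\<bar>t\<bar> < 1"
    for c :: "nat \<Rightarrow> complex" and t :: real
  proof (rule summable_comparison_test')
    show "summable (\<lambda>n. (norm (diffs c n))\<^sup>2 * \<bar>t\<bar> ^ n)"
      by (rule summable_norm_square_powser(2)) (use diff[OF c] t in auto)
    fix n
    have "1 * (real (Suc n) * (norm (c (Suc n)))\<^sup>2 * \<bar>t\<bar> ^ n)
        \<le> real (Suc n) * (real (Suc n) * (norm (c (Suc n)))\<^sup>2 * \<bar>t\<bar> ^ n)"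
      by (rule mult_right_mono) auto
    thus "norm (real (Suc n) * (norm (c (Suc n)))\<^sup>2 * t ^ n) \<le> (norm (diffs c n))\<^sup>2 * \<bar>t\<bar> ^ n"
      unfolding norm_diffs by (simp add: abs_mult power_abs mult_ac del: of_nat_Suc)
  qed
  have e: "0 \<le> (\<Sum>n. real (Suc n) * d n * t ^ n)" if "0 \<le> t" "t < 1" for t
  proof (rule powser_nonneg_if_weighted_nonneg[OF _ _ that])
    fix s :: real assume s: "\<bar>s\<bar> < 1"
    show "summable (\<lambda>n. real (Suc n) * d n * s ^ n)"
      using summable_diff[OF summable_mult[OF weighted[OF a s], of "k\<^sup>2"] weighted[OF b s]]
      by (simp add: d_def algebra_simps)
  next
    fix s :: real assume s: "0 \<le> s" "s < 1"
    hence s1: "\<bar>s\<bar> < 1" by simp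
    let ?c = "\<lambda>c n. diffs c n * complex_of_real (sqrt \<bar>s\<bar>) ^ n"
    have "(\<Sum>n. (norm (?c b n))\<^sup>2) \<le> k\<^sup>2 * (\<Sum>n. (norm (?c a n))\<^sup>2)"
    proof (rule sum_norm_square_le_if_dominated_on_circle[OF _ _ k])
      fix z :: complex assume "norm z = 1"
      hence "norm (of_real (sqrt \<bar>s\<bar>) * z) < 1" using s by (simp add: norm_mult)
      from dom[OF this] show "norm (\<Sum>n. ?c b n * z ^ n) \<le> k * norm (\<Sum>n. ?c a n * z ^ n)"
        by (simp add: power_mult_distrib mult_ac)
    qed (intro summable_norm_square_powser(1)[OF diff s1] a b; assumption)+
    moreover have "(norm (?c c n))\<^sup>2 = (norm (diffs c n))\<^sup>2 * s ^ n" for c n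
    proof -
      have "(sqrt s ^ n)\<^sup>2 = s ^ n" by (metis s(1) power_mult mult.commute real_sqrt_pow2)
      thus ?thesis using s by (simp add: norm_mult norm_power power_mult_distrib)
    qed
    ultimately have "0 \<le> k\<^sup>2 * (\<Sum>n. (norm (diffs a n))\<^sup>2 * s ^ n) - (\<Sum>n. (norm (diffs b n))\<^sup>2 * s ^ n)"
      by simp
    also have "\<dots> = (\<Sum>n. k\<^sup>2 * ((norm (diffs a n))\<^sup>2 * s ^ n) - (norm (diffs b n))\<^sup>2 * s ^ n)"
      by (subst suminf_mult[symmetric], intro summable_norm_square_powser(2)[OF diff s1] a; assumption?)
        (intro suminf_diff summable_mult summable_norm_square_powser(2)[OF diff s1] a b; assumption)
    also have "\<dots> = (\<Sum>n. real (Suc n) * (real (Suc n) * d n) * s ^ n)"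
      unfolding norm_diffs d_def by (rule arg_cong[of _ _ suminf]) (simp only: algebra_simps)
    finally show "0 \<le> (\<Sum>n. real (Suc n) * (real (Suc n) * d n) * s ^ n)" .
  qed
  have s1: "\<bar>t\<bar> < 1 \<Longrightarrow> summable (\<lambda>n. k\<^sup>2 * ((norm (a (Suc n)))\<^sup>2 * t ^ n))" for t
    by (intro summable_mult shift a)
  have s2: "\<bar>t\<bar> < 1 \<Longrightarrow> summable (\<lambda>n. (norm (b (Suc n)))\<^sup>2 * t ^ n)" for t
    by (intro shift b)
  have "0 \<le> (\<Sum>n. d n * x ^ n)"
    by (rule powser_nonneg_if_weighted_nonneg[OF _ e x])
      (use summable_diff[OF s1 s2] in \<open>auto simp: d_def algebra_simps\<close>)
  also have "\<dots> = (\<Sum>n. k\<^sup>2 * ((norm (a (Suc n)))\<^sup>2 * x ^ n)) - (\<Sum>n. (norm (b (Suc n)))\<^sup>2 * x ^ n)"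
    using suminf_diff[OF s1 s2, of x x] x by (simp add: d_def algebra_simps)
  also have "(\<Sum>n. k\<^sup>2 * ((norm (a (Suc n)))\<^sup>2 * x ^ n)) = k\<^sup>2 * (\<Sum>n. (norm (a (Suc n)))\<^sup>2 * x ^ n)"
    by (intro suminf_mult shift a) (use x in auto)
  finally show ?thesis by simp
qed

text \<open>The sum over \<open>a\<close> is dominated by a geometric series. For the sum over \<open>b\<close> only a
  square-sum is known. Cauchy-Schwarz with the weights \<open>r ^ Suc n\<close> still gives
  \<open>k\<close> times the bound for \<open>a\<close>, since its two factors are at most
  \<open>k\<^sup>2 * A\<^sup>2 * (r / (1 - r))\<close> and \<open>r / (1 - r)\<close>.\<close>

lemma partial_sums_le_geometric:
  fixes a b :: "nat \<Rightarrow> complex"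
  assumes aA: "\<And>n. norm (a (Suc n)) \<le> A"
    and sb: "summable (\<lambda>n. (norm (b (Suc n)))\<^sup>2 * r ^ n)"
    and sq: "(\<Sum>n. (norm (b (Suc n)))\<^sup>2 * r ^ n) \<le> k\<^sup>2 * (\<Sum>n. (norm (a (Suc n)))\<^sup>2 * r ^ n)"
    and k: "k \<ge> 0" and r: "0 \<le> r" "r < 1"
  shows "(\<Sum>n<N. (norm (a (Suc n)) + norm (b (Suc n))) * r ^ Suc n) \<le> (1 + k) * A * (r / (1 - r))"
proof -
  have A0: "A \<ge> 0" using aA[of 0] norm_ge_zero order_trans by blast
  have geo: "(\<Sum>n. r ^ n) = 1 / (1 - r)" "summable (\<lambda>n. r ^ n)"
    using r by (simp_all add: suminf_geometric summable_geometric)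
  have gN: "(\<Sum>n<N. r ^ Suc n) \<le> r / (1 - r)"
  proof -
    have "(\<Sum>n<N. r ^ n) \<le> 1 / (1 - r)"
      unfolding geo(1)[symmetric] using geo(2) r by (intro sum_le_suminf) auto
    from mult_left_mono[OF this r(1)] show ?thesis by (simp add: sum_distrib_left)
  qed
  have aN: "(\<Sum>n<N. norm (a (Suc n)) * r ^ Suc n) \<le> A * (r / (1 - r))"
  proof -
    have "(\<Sum>n<N. norm (a (Suc n)) * r ^ Suc n) \<le> (\<Sum>n<N. A * r ^ Suc n)"
      using aA r by (intro sum_mono mult_right_mono) auto
    also have "\<dots> \<le> A * (r / (1 - r))"
      unfolding sum_distrib_left[symmetric] by (rule mult_left_mono[OF gN A0])
    finally show ?thesis .
  qed
  have a2: "(\<Sum>n. (norm (a (Suc n)))\<^sup>2 * r ^ n) \<le> A\<^sup>2 * (1 / (1 - r))"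
  proof -
    have le: "(norm (a (Suc n)))\<^sup>2 * r ^ n \<le> A\<^sup>2 * r ^ n" for n
      using aA[of n] r by (intro mult_right_mono power_mono) auto
    have sA: "summable (\<lambda>n. A\<^sup>2 * r ^ n)" using geo(2) by (rule summable_mult)
    have "summable (\<lambda>n. (norm (a (Suc n)))\<^sup>2 * r ^ n)"
      by (rule summable_comparison_test'[OF sA]) (use le r in auto)
    from suminf_le[OF le this sA] show ?thesis
      using geo by (simp add: suminf_mult)
  qed
  have b2: "(\<Sum>n<N. (norm (b (Suc n)))\<^sup>2 * r ^ Suc n) \<le> k\<^sup>2 * A\<^sup>2 * (r / (1 - r))"
  proof -
    have "(\<Sum>n<N. (norm (b (Suc n)))\<^sup>2 * r ^ n) \<le> (\<Sum>n. (norm (b (Suc n)))\<^sup>2 * r ^ n)"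
      using sb r by (intro sum_le_suminf) auto
    also have "\<dots> \<le> k\<^sup>2 * (A\<^sup>2 * (1 / (1 - r)))"
      using sq mult_left_mono[OF a2, of "k\<^sup>2"] by auto
    finally have "r * (\<Sum>n<N. (norm (b (Suc n)))\<^sup>2 * r ^ n) \<le> r * (k\<^sup>2 * (A\<^sup>2 * (1 / (1 - r))))"
      using r by (intro mult_left_mono)
    thus ?thesis by (simp add: sum_distrib_left mult_ac)
  qed
  have sqr: "sqrt (r ^ Suc n) * sqrt (r ^ Suc n) = r ^ Suc n" for n
    using r by (intro real_sqrt_mult_self[THEN trans]) simp
  have "(\<Sum>n<N. norm (b (Suc n)) * r ^ Suc n)\<^sup>2
      = (\<Sum>n<N. (norm (b (Suc n)) * sqrt (r ^ Suc n)) * sqrt (r ^ Suc n))\<^sup>2"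
    by (simp only: mult.assoc sqr)
  also have "\<dots> \<le> (\<Sum>n<N. (norm (b (Suc n)) * sqrt (r ^ Suc n))\<^sup>2) * (\<Sum>n<N. (sqrt (r ^ Suc n))\<^sup>2)"
    by (rule Cauchy_Schwarz_ineq_sum)
  also have "\<dots> = (\<Sum>n<N. (norm (b (Suc n)))\<^sup>2 * r ^ Suc n) * (\<Sum>n<N. r ^ Suc n)"
    by (simp only: power_mult_distrib power2_eq_square[of "sqrt _"] sqr)
  also have "\<dots> \<le> (k\<^sup>2 * A\<^sup>2 * (r / (1 - r))) * (r / (1 - r))"
    using r by (intro mult_mono b2 gN sum_nonneg mult_nonneg_nonneg) auto
  also have "\<dots> = (k * A * (r / (1 - r)))\<^sup>2" by (simp add: power2_eq_square)
  finally have "(\<Sum>n<N. norm (b (Suc n)) * r ^ Suc n) \<le> k * A * (r / (1 - r))"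
    by (rule power2_le_imp_le) (use k A0 r in auto)
  with aN have "(\<Sum>n<N. norm (a (Suc n)) * r ^ Suc n) + (\<Sum>n<N. norm (b (Suc n)) * r ^ Suc n)
      \<le> A * (r / (1 - r)) + k * A * (r / (1 - r))"
    by (rule add_mono)
  also have "\<dots> = (1 + k) * A * (r / (1 - r))" by (simp only: distrib_right mult_1)
  finally show ?thesis by (simp only: distrib_right sum.distrib)
qed

section \<open>Wirtinger derivatives of harmonic mappings\<close>

text \<open>The directional derivative has the shape \<open>holomorphic + cnj holomorphic\<close> again, so the lemma
  applies to itself and yields the second derivatives.\<close>

lemma harmonic_sum_dir_deriv:
  assumes S: "open S" and h: "h holomorphic_on S" and g: "g holomorphic_on S"
    and f: "\<And>z. z \<in> S \<Longrightarrow> f z = h z + cnj (g z)" and z: "z \<in> S"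
  shows "f differentiable (at z)"
    and "dir_deriv v f z = v * deriv h z + cnj (v * deriv g z)"
proof -
  have "(h has_derivative (*) (deriv h z)) (at z)" "(g has_derivative (*) (deriv g z)) (at z)"
    using holomorphic_derivI[OF h S z] holomorphic_derivI[OF g S z]
    by (auto simp: has_field_derivative_def)
  hence "((\<lambda>z. h z + cnj (g z)) has_derivative (\<lambda>v. deriv h z * v + cnj (deriv g z * v))) (at z)"
    by (intro has_derivative_add bounded_linear.has_derivative[OF bounded_linear_cnj])
  hence d: "(f has_derivative (\<lambda>v. deriv h z * v + cnj (deriv g z * v))) (at z)"
    by (rule has_derivative_transform_within_open[OF _ S z]) (simp add: f)
  thus "f differentiable (at z)" by (auto simp: differentiable_def)
  show "dir_deriv v f z = v * deriv h z + cnj (v * deriv g z)"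
    unfolding dir_deriv_def frechet_derivative_at[OF d, symmetric] by (simp add: mult.commute)
qed

lemma harmonic_sum_wirtinger:
  assumes "open S" "h holomorphic_on S" "g holomorphic_on S"
    "\<And>z. z \<in> S \<Longrightarrow> f z = h z + cnj (g z)" "z \<in> S"
  shows "wirtinger_z f z = deriv h z" "wirtinger_zbar f z = cnj (deriv g z)"
proof -
  have "dir_deriv v f z = v * deriv h z + cnj (v * deriv g z)" for v
    by (rule harmonic_sum_dir_deriv(2)) (use assms in auto)
  thus "wirtinger_z f z = deriv h z" "wirtinger_zbar f z = cnj (deriv g z)"
    by (simp_all add: wirtinger_z_def wirtinger_zbar_def algebra_simps)
qed

lemma harmonic_sum_dir_deriv_continuous:
  assumes S: "open S" and h: "h holomorphic_on S" and g: "g holomorphic_on S"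
    and f: "\<And>z. z \<in> S \<Longrightarrow> f z = h z + cnj (g z)"
  shows "continuous_on S f" "continuous_on S (dir_deriv v f)"
proof -
  have "continuous_on S (\<lambda>z. h z + cnj (g z))"
    by (intro continuous_intros holomorphic_on_imp_continuous_on h g)
  thus "continuous_on S f" using f continuous_on_cong by force
  have "continuous_on S (\<lambda>z. v * deriv h z + cnj (v * deriv g z))"
    by (intro continuous_intros holomorphic_on_imp_continuous_on holomorphic_deriv h g S)
  thus "continuous_on S (dir_deriv v f)"
    using harmonic_sum_dir_deriv(2)[OF S h g f] by (subst continuous_on_cong[OF refl]) auto
qed

lemma harmonic_mapping_on_sum:
  assumes S: "open S" and h: "h holomorphic_on S" and g: "g holomorphic_on S"
    and f: "\<And>z. z \<in> S \<Longrightarrow> f z = h z + cnj (g z)"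
  shows "harmonic_mapping_on S f"
proof -
  have hol: "(\<lambda>z. v * deriv h z) holomorphic_on S" "(\<lambda>z. v * deriv g z) holomorphic_on S" for v
    by (intro holomorphic_intros h g S)+
  have D: "dir_deriv v f z = v * deriv h z + cnj (v * deriv g z)" if "z \<in> S" for v z
    by (rule harmonic_sum_dir_deriv(2)[OF S h g]) (use f that in auto)
  note second = harmonic_sum_dir_deriv[OF S hol(1) hol(2) D]
    harmonic_sum_dir_deriv_continuous[OF S hol(1) hol(2) D]
  have dd: "deriv (\<lambda>z. v * deriv u z) z = v * deriv (deriv u) z"
    if "u holomorphic_on S" "z \<in> S" for u v z
    by (rule deriv_cmult, rule holomorphic_on_imp_differentiable_at[OF holomorphic_deriv])
      (use that S in auto)
  show ?thesis
    unfolding harmonic_mapping_on_def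
  proof (intro conjI ballI)
    fix z assume z: "z \<in> S"
    show "f differentiable at z" by (rule harmonic_sum_dir_deriv[OF S h g f z])
    show "dir_deriv v f differentiable at z" for v by (rule second(1)[OF _ z])
    show "dir_deriv 1 (dir_deriv 1 f) z + dir_deriv \<i> (dir_deriv \<i> f) z = 0"
      using z by (subst (1 2) second(2)) (auto simp: dd[OF h] dd[OF g])
  qed (rule second(4))
qed

section \<open>Continuously differentiable functions are locally Sobolev\<close>

lemma compactly_supported_extension:
  fixes P :: "complex \<Rightarrow> complex"
  assumes S: "open S" and C: "compact C" "C \<subseteq> S" and P: "continuous_on S P"
    and zero: "\<And>z. z \<notin> C \<Longrightarrow> P z = 0"
  shows "continuous_on UNIV P" "integrable lborel P"
    "(LINT z|lebesgue_on S. P z) = (LINT z|lborel. P z)"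
proof -
  have "continuous_on (- C) P" by (rule continuous_on_eq[of _ "\<lambda>_. 0"]) (auto simp: zero)
  hence "continuous_on (S \<union> - C) P"
    using P S C compact_imp_closed by (intro continuous_on_open_Un) auto
  thus cont: "continuous_on UNIV P" using C by (auto simp: Un_absorb1 elim: continuous_on_subset)
  have "indicator C z *\<^sub>R P z = P z" "indicator S z *\<^sub>R P z = P z" for z
    using zero C(2) by (auto simp: indicator_def)
  note ind = this
  have "integrable lborel (\<lambda>z. indicator C z *\<^sub>R P z)"
    by (rule borel_integrable_compact[OF C(1)]) (use P C continuous_on_subset in blast)
  thus "integrable lborel P" by (simp add: ind)
  have "P \<in> borel_measurable lborel" using cont by (simp add: borel_measurable_continuous_onI)
  thus "(LINT z|lebesgue_on S. P z) = (LINT z|lborel. P z)"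
    using S by (subst integral_restrict_space) (auto simp: ind integral_completion)
qed

text \<open>Used off the support of a test function, where the product with that function vanishes
  identically although the other factor may fail to be differentiable.\<close>

lemma dir_deriv_eq_0_if_locally_zero:
  fixes F :: "complex \<Rightarrow> 'b::real_normed_vector"
  assumes "open U" "z \<in> U" "\<And>w. w \<in> U \<Longrightarrow> F w = 0"
  shows "(F has_derivative (\<lambda>_. 0)) (at z)" "dir_deriv v F z = 0"
proof -
  show d: "(F has_derivative (\<lambda>_. 0)) (at z)"
    by (rule has_derivative_transform_within_open[OF has_derivative_const[of 0] assms(1,2)])
      (simp add: assms(3))
  show "dir_deriv v F z = 0"
    unfolding dir_deriv_def frechet_derivative_at[OF d, symmetric] ..
qed

text \<open>Lebesgue measure is invariant under translation, so every difference quotient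
  \<open>(F (z + t * v) - F z) / t\<close> has integral zero. By the mean value inequality those with \<open>0 < t \<le> 1\<close> are
  uniformly bounded, with supports in one fixed disk, and dominated convergence gives the claim.\<close>

lemma integral_dir_deriv_compact_support:
  fixes F :: "complex \<Rightarrow> complex"
  assumes diff: "\<And>z. F differentiable (at z)" and cont: "continuous_on UNIV (dir_deriv v F)"
    and C: "compact C" and zero: "\<And>z. z \<notin> C \<Longrightarrow> F z = 0"
  shows "(LINT z|lborel. dir_deriv v F z) = 0"
proof -
  have contF: "continuous_on UNIV F"
    using diff by (simp add: continuous_at_imp_continuous_on differentiable_imp_continuous_within)
  have intF: "integrable lborel F"
    by (rule compactly_supported_extension[OF open_UNIV C _ contF zero]) auto
  have zero': "dir_deriv v F z = 0" if "z \<notin> C" for z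
    by (rule dir_deriv_eq_0_if_locally_zero[of "- C"]) (use C that zero compact_imp_closed in auto)
  obtain R where R: "\<And>z. z \<in> C \<Longrightarrow> norm z \<le> R" "R > 0"
    using compact_imp_bounded[OF C] bounded_pos by metis
  have "bounded (dir_deriv v F ` C)"
    by (intro compact_imp_bounded compact_continuous_image C) (use cont continuous_on_subset in blast)
  then obtain B where B: "B > 0" "\<And>z. z \<in> C \<Longrightarrow> norm (dir_deriv v F z) \<le> B"
    by (auto simp: bounded_pos)
  have B': "norm (dir_deriv v F z) \<le> B" for z
    using B zero'[of z] by (cases "z \<in> C") auto
  have line: "((\<lambda>t. F (z + of_real t * v)) has_vector_derivative dir_deriv v F (z + of_real t * v)) (at t)"
    for z t
  proof -
    have "((\<lambda>t. z + of_real t * v) has_derivative (\<lambda>s. of_real s * v)) (at t)"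
      by (auto intro!: derivative_eq_intros)
    moreover have "(F has_derivative frechet_derivative F (at (z + of_real t * v))) (at (z + of_real t * v))"
      using diff frechet_derivative_works by blast
    ultimately have "((\<lambda>t. F (z + of_real t * v)) has_derivative
        (\<lambda>s. frechet_derivative F (at (z + of_real t * v)) (of_real s * v))) (at t)"
      by (rule has_derivative_compose)
    moreover have "frechet_derivative F (at w) (of_real s * v) = s *\<^sub>R dir_deriv v F w" for s w
      unfolding dir_deriv_def scaleR_conv_of_real[symmetric]
      using linear_frechet_derivative[OF diff] by (rule linear_cmul)
    ultimately show ?thesis by (simp add: has_vector_derivative_def)
  qed
  define e where "e n = 1 / real (Suc n)" for n
  have e: "0 < e n" "e n \<le> 1" for n by (auto simp: e_def)
  define s where "s n z = (1 / e n) *\<^sub>R (F (z + of_real (e n) * v) - F z)" for n z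
  have e_lim: "filterlim e (at 0) sequentially"
    unfolding filterlim_at using LIMSEQ_inverse_real_of_nat e
    by (auto simp: e_def[abs_def] inverse_eq_divide eventually_sequentially)
  have s_lim: "(\<lambda>n. s n z) \<longlonglongrightarrow> dir_deriv v F z" for z
  proof -
    have "((\<lambda>t. norm (F (z + of_real t * v) - F z - t *\<^sub>R dir_deriv v F z) / norm t) \<longlongrightarrow> 0) (at 0)"
      using line[of z 0] by (simp add: has_vector_derivative_def has_derivative_iff_norm)
    from filterlim_compose[OF this e_lim]
    have "(\<lambda>n. norm (F (z + of_real (e n) * v) - F z - e n *\<^sub>R dir_deriv v F z) / norm (e n)) \<longlonglongrightarrow> 0" .
    moreover have "norm (F (z + of_real (e n) * v) - F z - e n *\<^sub>R dir_deriv v F z) / norm (e n)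
        = norm (s n z - dir_deriv v F z)" for n
    proof -
      have "s n z - dir_deriv v F z = (1 / e n) *\<^sub>R (F (z + of_real (e n) * v) - F z - e n *\<^sub>R dir_deriv v F z)"
        using e[of n] by (simp add: s_def scaleR_diff_right)
      thus ?thesis by simp
    qed
    ultimately show ?thesis by (simp add: Lim_null[of _ "dir_deriv v F z"] tendsto_norm_zero_iff)
  qed
  have s_bound: "norm (s n z) \<le> indicator (cball 0 (R + norm v)) z *\<^sub>R B" for n z
  proof (cases "z \<in> cball 0 (R + norm v)")
    case True
    have "norm (F (z + of_real (e n) * v) - F (z + of_real 0 * v)) \<le> B * norm (e n - 0)"
      by (rule differentiable_bound[of "{0..e n}" _ "\<lambda>t s. s *\<^sub>R dir_deriv v F (z + of_real t * v)"])
        (use line e[of n] B' in \<open>auto simp: has_vector_derivative_def onorm_scaleR_left onorm_id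
          intro: has_derivative_at_withinI\<close>)
    thus ?thesis using True e[of n] unfolding s_def norm_scaleR by (simp add: field_simps)
  next
    case False
    hence "norm z > R + norm v" by simp
    moreover have "norm (of_real (e n) * v) \<le> 1 * norm v"
      unfolding norm_mult by (rule mult_right_mono) (use e[of n] in auto)
    moreover have "norm z \<le> norm (z + of_real (e n) * v) + norm (of_real (e n) * v)"
      using norm_triangle_ineq4[of "z + of_real (e n) * v" "of_real (e n) * v"] by simp
    ultimately have "z \<notin> C" "z + of_real (e n) * v \<notin> C"
      using R norm_ge_zero[of v] by (smt (verit))+
    thus ?thesis using False by (simp add: s_def zero)
  qed
  have trans: "integrable lborel (\<lambda>z. F (z + c))" "(LINT z|lborel. F (z + c)) = (LINT z|lborel. F z)" for c
  proof -
    have m: "F \<in> borel_measurable borel" using contF by (simp add: borel_measurable_continuous_onI)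
    show "(LINT z|lborel. F (z + c)) = (LINT z|lborel. F z)"
      using integral_distr[of "(+) c" lborel borel F] m by (simp add: lborel_distr_plus add.commute)
    show "integrable lborel (\<lambda>z. F (z + c))"
      using integrable_distr_eq[of "(+) c" lborel borel F] m intF by (simp add: lborel_distr_plus add.commute)
  qed
  have "(LINT z|lborel. s n z) = 0" for n
    unfolding s_def using trans intF by simp
  moreover have "(\<lambda>n. LINT z|lborel. s n z) \<longlonglongrightarrow> (LINT z|lborel. dir_deriv v F z)"
  proof (rule integral_dominated_convergence)
    show "dir_deriv v F \<in> borel_measurable lborel" using cont by (simp add: borel_measurable_continuous_onI)
    show "s n \<in> borel_measurable lborel" for n
      unfolding s_def using trans(1) intF by (intro borel_measurable_integrable) auto
    show "integrable lborel (\<lambda>z::complex. indicator (cball 0 (R + norm v)) z *\<^sub>R B)"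
      by (rule borel_integrable_compact) auto
    show "AE z in lborel. (\<lambda>n. s n z) \<longlonglongrightarrow> dir_deriv v F z" by (intro AE_I2 s_lim)
    show "AE z in lborel. norm (s n z) \<le> indicator (cball 0 (R + norm v)) z *\<^sub>R B" for n
      by (intro AE_I2 s_bound)
  qed
  ultimately show ?thesis by (simp add: LIMSEQ_const_iff)
qed

text \<open>A classical derivative is a weak one: by the product rule the two integrands add up to the
  derivative of \<open>f * \<phi>\<close>, which has compact support and hence integral zero.\<close>

lemma weak_dir_deriv_on_dir_deriv:
  assumes S: "open S" and f: "\<And>z. z \<in> S \<Longrightarrow> f differentiable (at z)"
    and df: "continuous_on S (dir_deriv v f)" and v: "v \<in> {1, \<i>}"
  shows "weak_dir_deriv_on S v f (dir_deriv v f)"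
  unfolding weak_dir_deriv_on_def
proof (intro allI impI)
  fix \<phi> assume "test_function_on S \<phi>"
  hence \<phi>: "\<And>z. \<phi> differentiable (at z)" and d\<phi>: "continuous_on UNIV (dir_deriv v \<phi>)"
    and C: "compact (closure {z. \<phi> z \<noteq> 0})" "closure {z. \<phi> z \<noteq> 0} \<subseteq> S"
    using v by (auto simp: test_function_on_def)
  define C where "C = closure {z. \<phi> z \<noteq> 0}"
  note C = C[folded C_def]
  have oC: "open (- C)" by (simp add: C_def open_Compl)
  have \<phi>0: "\<phi> z = 0" if "z \<notin> C" for z
    using that closure_subset[of "{z. \<phi> z \<noteq> 0}"] by (auto simp: C_def)
  have d\<phi>0: "dir_deriv v \<phi> z = 0" if "z \<notin> C" for z
    by (rule dir_deriv_eq_0_if_locally_zero[OF oC]) (use that \<phi>0 in auto)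
  define P where "P z = f z * complex_of_real (dir_deriv v \<phi> z)" for z
  define Q where "Q z = dir_deriv v f z * complex_of_real (\<phi> z)" for z
  define F where "F z = f z * complex_of_real (\<phi> z)" for z
  have F0: "F z = 0" if "z \<notin> C" for z using that \<phi>0 by (simp add: F_def)
  have F: "F differentiable (at z) \<and> dir_deriv v F z = P z + Q z" for z
  proof (cases "z \<in> S")
    case True
    have "(F has_derivative (\<lambda>u. f z * of_real (frechet_derivative \<phi> (at z) u)
        + frechet_derivative f (at z) u * of_real (\<phi> z))) (at z)"
      unfolding F_def using f[OF True] \<phi>[of z]
      by (intro has_derivative_mult has_derivative_of_real) (simp_all add: frechet_derivative_works)
    note d = this
    show ?thesis using d frechet_derivative_at[OF d]
      by (auto simp: differentiable_def P_def Q_def dir_deriv_def dest: fun_cong[of _ _ v])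
  next
    case False
    hence z: "z \<in> - C" using C by auto
    have "(F has_derivative (\<lambda>_. 0)) (at z)" "dir_deriv v F z = 0"
      by (rule dir_deriv_eq_0_if_locally_zero[OF oC z]; use F0 in auto)+
    moreover have "P z = 0" "Q z = 0" using z d\<phi>0 \<phi>0 by (auto simp: P_def Q_def)
    ultimately show ?thesis by (auto simp: differentiable_def)
  qed
  have cf: "continuous_on S f"
    using f by (simp add: continuous_at_imp_continuous_on differentiable_imp_continuous_within)
  have c\<phi>: "continuous_on UNIV \<phi>"
    using \<phi> by (simp add: continuous_at_imp_continuous_on differentiable_imp_continuous_within)
  have "continuous_on S P" unfolding P_def
    by (intro continuous_intros cf continuous_on_subset[OF d\<phi>]) auto
  note P = compactly_supported_extension[OF S C this]
  have "continuous_on S Q" unfolding Q_def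
    by (intro continuous_intros df continuous_on_subset[OF c\<phi>]) auto
  note Q = compactly_supported_extension[OF S C this]
  have z: "P z = 0" "Q z = 0" if "z \<notin> C" for z
    using that d\<phi>0 \<phi>0 by (auto simp: P_def Q_def)
  have "continuous_on UNIV (dir_deriv v F)"
    using continuous_on_add[OF P(1) Q(1)] z F by simp
  from integral_dir_deriv_compact_support[OF _ this C(1) F0]
  have "(LINT z|lborel. P z + Q z) = 0" using F by simp
  hence "(LINT z|lborel. P z) = - (LINT z|lborel. Q z)"
    using P(2) Q(2) z by (simp add: Bochner_Integration.integral_add eq_neg_iff_add_eq_0)
  thus "(LINT z|lebesgue_on S. f z * of_real (dir_deriv v \<phi> z)) =
      - (LINT z|lebesgue_on S. dir_deriv v f z * of_real (\<phi> z))"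
    using P(3) Q(3) z by (simp add: P_def Q_def)
qed

lemma L2_loc_continuous:
  assumes "open S" "continuous_on S u"
  shows "L2_loc S u"
  unfolding L2_loc_def
proof (intro conjI allI impI)
  show "u \<in> borel_measurable (lebesgue_on S)"
    using assms by (intro continuous_imp_measurable_on_sets_lebesgue) auto
  fix C assume C: "compact C \<and> C \<subseteq> S"
  hence "continuous_on C (\<lambda>z. (norm (u z))\<^sup>2)"
    using assms by (intro continuous_intros) (auto elim: continuous_on_subset)
  hence "integrable lborel (\<lambda>z. indicator C z *\<^sub>R (norm (u z))\<^sup>2)"
    using C by (intro borel_integrable_compact) auto
  hence "integrable lebesgue (\<lambda>z. indicator C z *\<^sub>R (norm (u z))\<^sup>2)"
    by (simp add: integrable_completion borel_measurable_integrable)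
  thus "integrable (lebesgue_on C) (\<lambda>z. (norm (u z))\<^sup>2)"
    using C by (subst integrable_restrict_space) (auto simp: compact_imp_closed)
qed

lemma W12_loc_C1:
  assumes "open S" "\<And>z. z \<in> S \<Longrightarrow> f differentiable (at z)"
    and "\<And>v. v \<in> {1, \<i>} \<Longrightarrow> continuous_on S (dir_deriv v f)"
  shows "W12_loc S f"
proof -
  have "continuous_on S f"
    using assms(2) by (simp add: continuous_at_imp_continuous_on differentiable_imp_continuous_within)
  thus ?thesis unfolding W12_loc_def
    using L2_loc_continuous weak_dir_deriv_on_dir_deriv assms by metis
qed

section \<open>The Bohr inequality\<close>

text \<open>The distortion inequality solved for the dilatation: \<open>|\<omega>| \<le> (K - 1) / (K + 1)\<close>.\<close>

lemma norm_wirtinger_zbar_le: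
  assumes "K \<ge> 1" "quasiconformal_harmonic K f" "z \<in> unit_disk"
  shows "norm (wirtinger_zbar f z) \<le> (K - 1) / (K + 1) * norm (wirtinger_z f z)"
    and "wirtinger_z f z \<noteq> 0"
proof -
  let ?p = "norm (wirtinger_z f z)" and ?q = "norm (wirtinger_zbar f z)"
  have "?q\<^sup>2 < ?p\<^sup>2" and ratio: "(?p + ?q) / (?p - ?q) \<le> K"
    using assms(2,3) by (auto simp: quasiconformal_harmonic_def sense_preserving_on_def jacobian_def)
  hence pq: "?q < ?p" by (simp add: power2_less_imp_less)
  hence "0 < ?p" using norm_ge_zero[of "wirtinger_zbar f z"] by linarith
  thus "wirtinger_z f z \<noteq> 0" by simp
  from ratio pq have "?p + ?q \<le> K * (?p - ?q)" by (simp add: field_simps)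
  thus "?q \<le> (K - 1) / (K + 1) * ?p" using \<open>K \<ge> 1\<close> by (simp add: field_simps)
qed

lemma deriv_powser_sum:
  fixes c :: "nat \<Rightarrow> complex"
  assumes "\<And>z. norm z < 1 \<Longrightarrow> (\<lambda>n. c n * z ^ n) sums u z" and "norm z < 1"
  shows "deriv u z = (\<Sum>n. diffs c n * z ^ n)"
proof -
  have "((\<lambda>z. \<Sum>n. c n * z ^ n) has_field_derivative (\<Sum>n. diffs c n * z ^ n)) (at z)"
    by (rule termdiffs_strong'[of 1]) (use assms in \<open>auto simp: sums_iff\<close>)
  hence "(u has_field_derivative (\<Sum>n. diffs c n * z ^ n)) (at z)"
    by (rule has_field_derivative_transform_within_open[of _ _ _ unit_disk])
      (use assms in \<open>auto simp: sums_iff\<close>)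
  thus ?thesis by (rule DERIV_imp_deriv)
qed

text \<open>With \<open>M = sup_norm h\<close> and \<open>A = (M\<^sup>2 - |a 0|\<^sup>2) / M\<close>, which bounds the higher coefficients of \<open>h\<close>, the sum from
  index one on is at most \<open>(1 + k) * A * (r / (1 - r))\<close>, and this is at most \<open>A\<close> because
  \<open>(1 + k) * (r / (1 - r)) \<le> 1\<close> is a rearrangement of \<open>r \<le> 1 / (2 + k)\<close>, the radius in question. The remaining inequality
  \<open>|a 0|\<^sup>2 + A \<le> M\<close> is where \<open>M \<le> 1\<close> enters.\<close>

lemma bohr_sum_le_sup_norm:
  assumes K: "K \<ge> 1" and f: "quasiconformal_harmonic K f"
    and rep: "canonical_representation f h g a b"
    and bdd: "bounded (h ` unit_disk)" and le1: "sup_norm h \<le> 1"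
    and r: "0 \<le> r" "r \<le> (K + 1) / (3 * K + 1)"
  shows "summable (bohr_terms a b r)" "bohr_sum a b r \<le> sup_norm h"
proof -
  define k where "k = (K - 1) / (K + 1)"
  define M where "M = sup_norm h"
  \<comment> \<open>Only the values of \<open>b\<close> from index one on are tied to \<open>g\<close>; \<open>g 0 = 0\<close> dictates the value at zero.\<close>
  define b' where "b' n = (if n = 0 then 0 else b n)" for n
  have k: "k \<ge> 0" using K by (simp add: k_def)
  have h: "h holomorphic_on unit_disk" and g: "g holomorphic_on unit_disk"
    and fhg: "\<And>z. z \<in> unit_disk \<Longrightarrow> f z = h z + cnj (g z)"
    and a_sums: "\<And>z. norm z < 1 \<Longrightarrow> (\<lambda>n. a n * z ^ n) sums h z"
    and b_sums: "\<And>z. norm z < 1 \<Longrightarrow> (\<lambda>n. b (Suc n) * z ^ Suc n) sums g z"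
    using rep by (auto simp: canonical_representation_def)
  have b'_sums: "(\<lambda>n. b' n * z ^ n) sums g z" if "norm z < 1" for z
    using sums_Suc[of "\<lambda>n. b' n * z ^ n" "g z"] b_sums[OF that] by (simp add: b'_def)
  have sa: "summable (\<lambda>n. a n * z ^ n)" and sb: "summable (\<lambda>n. b' n * z ^ n)" if "norm z < 1" for z
    using a_sums[OF that] b'_sums[OF that] by (simp_all add: sums_iff)
  note w = harmonic_sum_wirtinger[OF open_ball h g fhg]
  have dom: "norm (deriv g z) \<le> k * norm (deriv h z)" and h': "deriv h z \<noteq> 0" if "norm z < 1" for z
    using norm_wirtinger_zbar_le[OF K f, of z] w[of z] that by (simp_all add: k_def)
  have hM: "norm (h z) \<le> M" if "norm z < 1" for z
    unfolding M_def sup_norm_def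
    by (rule cSUP_upper) (use that bdd in \<open>auto simp: bounded_iff bdd_above_def\<close>)
  have "M \<noteq> 0"
  proof
    assume "M = 0"
    hence "h z = 0" if "norm z < 1" for z using hM[OF that] by simp
    hence "(h has_field_derivative 0) (at 0)"
      by (intro has_field_derivative_transform_within_open[OF DERIV_const open_ball, of 0 0 1 0]) auto
    with h'[of 0] show False by (simp add: DERIV_imp_deriv)
  qed
  moreover have "0 \<le> M" by (rule order_trans[OF norm_ge_zero hM[of 0]]) simp
  ultimately have M: "M > 0" by simp
  define A where "A = (M\<^sup>2 - (norm (a 0))\<^sup>2) / M"
  have aA: "norm (a (Suc n)) \<le> A" for n
    using bounded_function_coefficient_bound[OF a_sums hM, of "Suc n"] M by (simp add: A_def field_simps)
  have r1: "r < 1"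
  proof -
    have "(K + 1) / (3 * K + 1) < 1" using K by simp
    with r(2) show ?thesis by linarith
  qed
  have kr: "(1 + k) * (r / (1 - r)) \<le> 1"
  proof -
    have "(3 * K + 1) * r \<le> K + 1" using r(2) K by (simp add: field_simps)
    moreover have "2 + k = (3 * K + 1) / (K + 1)" using K by (simp add: k_def field_simps)
    ultimately have "(2 + k) * r \<le> 1" using K by simp
    thus ?thesis using r1 by (simp add: field_simps)
  qed
  have x: "\<bar>r\<bar> < 1" using r r1 by simp
  have sb2: "summable (\<lambda>n. (norm (b' (Suc n)))\<^sup>2 * r ^ n)"
    by (rule summable_norm_square_powser(2)[OF _ x]) (use sb summable_powser_split_head in blast)
  have sq: "(\<Sum>n. (norm (b' (Suc n)))\<^sup>2 * r ^ n) \<le> k\<^sup>2 * (\<Sum>n. (norm (a (Suc n)))\<^sup>2 * r ^ n)"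
    by (rule sum_norm_square_coeffs_le_if_derivative_dominated[OF sa sb k _ r(1) r1])
      (use dom deriv_powser_sum[OF a_sums] deriv_powser_sum[OF b'_sums] in auto)
  have A0: "A \<ge> 0" using aA[of 0] norm_ge_zero order_trans by blast
  have partial: "(\<Sum>n<N. bohr_terms a b r n) \<le> A" for N
  proof -
    have "(\<Sum>n<N. bohr_terms a b r n) \<le> (1 + k) * A * (r / (1 - r))"
      using partial_sums_le_geometric[OF aA sb2 sq k r(1) r1, of N]
      by (simp add: bohr_terms_def b'_def)
    also have "\<dots> \<le> 1 * A" using mult_right_mono[OF kr A0] by (simp add: mult_ac)
    finally show ?thesis by simp
  qed
  have nonneg: "0 \<le> bohr_terms a b r n" for n using r by (simp add: bohr_terms_def)
  show sm: "summable (bohr_terms a b r)"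
    by (rule summableI_nonneg_bounded[OF nonneg partial])
  have "bohr_sum a b r \<le> (norm (a 0))\<^sup>2 + A"
    unfolding bohr_sum_def using suminf_le_const[OF sm partial] by simp
  also have "\<dots> = M - (norm (a 0))\<^sup>2 * (1 - M) / M"
    using M by (simp add: A_def power2_eq_square field_simps)
  also have "\<dots> \<le> M" using M le1 by (simp add: M_def)
  finally show "bohr_sum a b r \<le> sup_norm h" by (simp add: M_def)
qed

section \<open>Sharpness of the radius\<close>

lemma Moebius_function_real:
  "Moebius_function 0 (of_real t) z = (z - of_real t) / (1 - of_real t * z)"
  by (simp add: Moebius_function_def)

text \<open>The nearly extremal mapping is \<open>h + cnj g\<close> with \<open>h\<close> a disk automorphism that sends \<open>t\<close> to \<open>0\<close>
  and \<open>g = k * (h - h 0)\<close>: an invertible real-affine map after \<open>h\<close>, with constant dilatation \<open>k\<close>. All bounds of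
  the positive part are then nearly attained, because \<open>|a (Suc n)| = (1 - t\<^sup>2) * t ^ n\<close> and \<open>|b (Suc n)| = k * |a (Suc n)|\<close>.
  The Bohr sum exceeds \<open>1\<close> as soon as \<open>r > 1 / (1 + k + t)\<close>, and this bound tends to
  \<open>1 / (2 + k)\<close> as \<open>t \<rightarrow> 1\<close>.\<close>

lemma bohr_sum_sharp:
  assumes K: "K \<ge> 1" and r: "(K + 1) / (3 * K + 1) < r" "r < 1"
  shows "\<exists>f h g a b.
    quasiconformal_harmonic K f \<and> canonical_representation f h g a b \<and>
    bounded (h ` unit_disk) \<and> sup_norm h = 1 \<and>
    summable (bohr_terms a b r) \<and> bohr_sum a b r > sup_norm h"
proof -
  define k where "k = (K - 1) / (K + 1)"
  have k: "0 \<le> k" "k < 1" using K by (simp_all add: k_def)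
  have kK: "(1 + k) / (1 - k) = K" using K by (simp add: k_def field_simps)
  have "0 < (K + 1) / (3 * K + 1)" using K by simp
  hence r0: "r > 0" using r by linarith
  have "1 / r - 1 - k < 1"
  proof -
    have "K + 1 < r * (3 * K + 1)" using r K by (simp add: field_simps)
    hence "1 / r < (3 * K + 1) / (K + 1)" using r0 K by (simp add: field_simps)
    moreover have "2 + k = (3 * K + 1) / (K + 1)" using K by (simp add: k_def field_simps)
    ultimately show ?thesis by simp
  qed
  hence "max 0 (1 / r - 1 - k) < 1" by simp
  then obtain t where "max 0 (1 / r - 1 - k) < t" and t1: "t < 1" using dense by blast
  hence t0: "0 < t" and t: "1 / r - 1 - k < t" by auto
  have t2: "t\<^sup>2 < 1" using t0 t1 by (simp add: power_less_one_iff)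
  let ?t = "complex_of_real t"
  have nt: "norm ?t < 1" using t0 t1 by simp
  define h where "h z = Moebius_function 0 ?t z" for z
  define g where "g z = of_real k * (h z + ?t)" for z
  define f where "f z = h z + cnj (g z)" for z
  define a where "a n = (case n of 0 \<Rightarrow> - ?t | Suc m \<Rightarrow> of_real ((1 - t\<^sup>2) * t ^ m))" for n
  define b where "b n = of_real k * a n" for n
  have nz: "1 - ?t * z \<noteq> 0" if "norm z < 1" for z
  proof
    assume "1 - ?t * z = 0"
    hence "norm (?t * z) = 1" by (metis norm_one right_minus_eq)
    moreover have "norm (?t * z) < 1" using norm_mult_less[OF nt that] by simp
    ultimately show False by simp
  qed
  have h_eq: "h z = (z - ?t) / (1 - ?t * z)" for z by (simp add: h_def Moebius_function_real)
  have h_hol: "h holomorphic_on unit_disk"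
    unfolding h_def[abs_def] by (rule Moebius_function_holomorphic[OF nt])
  have g_hol: "g holomorphic_on unit_disk"
    unfolding g_def[abs_def] by (intro holomorphic_intros h_hol)
  have h_deriv: "deriv h z = of_real (1 - t\<^sup>2) / (1 - ?t * z)\<^sup>2" if "norm z < 1" for z
  proof (rule DERIV_imp_deriv)
    show "(h has_field_derivative of_real (1 - t\<^sup>2) / (1 - ?t * z)\<^sup>2) (at z)"
      unfolding h_eq[abs_def] using nz[OF that]
      by (auto intro!: derivative_eq_intros simp: power2_eq_square algebra_simps)
  qed
  have h'0: "deriv h z \<noteq> 0" if "norm z < 1" for z
    using h_deriv[OF that] nz[OF that] t2 by (simp flip: of_real_power)
  have g_deriv: "deriv g z = of_real k * deriv h z" if "norm z < 1" for z
  proof (rule DERIV_imp_deriv)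
    have "(h has_field_derivative deriv h z) (at z)"
      by (rule holomorphic_derivI[OF h_hol]) (use that in auto)
    thus "(g has_field_derivative of_real k * deriv h z) (at z)"
      unfolding g_def[abs_def] by (auto intro!: derivative_eq_intros)
  qed
  have wirt: "wirtinger_z f z = deriv h z" "norm (wirtinger_zbar f z) = k * norm (deriv h z)"
    if "norm z < 1" for z
    using harmonic_sum_wirtinger[OF open_ball h_hol g_hol, of f z] that k g_deriv
    by (simp_all add: f_def norm_mult)

  \<comment> \<open>The automorphism has an inverse of the same form, and \<open>w + k * cnj w\<close> determines \<open>w\<close> because \<open>k < 1\<close>.\<close>
  have h_inj: "z = w" if "norm z < 1" "norm w < 1" "h z = h w" for z w
    using Moebius_function_compose[of "- ?t" ?t] nt that by (metis h_def add.inverse_inverse norm_minus_cancel)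
  have f_inj: "inj_on f unit_disk"
  proof (rule inj_onI)
    fix z w assume zw: "z \<in> unit_disk" "w \<in> unit_disk" "f z = f w"
    have "h z - h w = - (of_real k * cnj (h z - h w))"
      using zw(3) by (simp add: f_def g_def algebra_simps)
    hence "norm (h z - h w) = k * norm (h z - h w)"
      using k by (metis norm_minus_cancel norm_mult norm_of_real abs_of_nonneg complex_mod_cnj)
    hence "h z = h w" using k by simp
    thus "z = w" using h_inj zw by simp
  qed
  have f_sum: "\<And>z. z \<in> unit_disk \<Longrightarrow> f z = h z + cnj (g z)" by (simp add: f_def)
  note cont = harmonic_sum_dir_deriv_continuous[OF open_ball h_hol g_hol f_sum]
  have qc: "quasiconformal_harmonic K f"
    unfolding quasiconformal_harmonic_def
  proof (intro conjI)
    show "harmonic_mapping_on unit_disk f"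
      by (rule harmonic_mapping_on_sum[OF open_ball h_hol g_hol f_sum])
    show "sense_preserving_on unit_disk f"
      unfolding sense_preserving_on_def jacobian_def
    proof
      fix z :: complex assume "z \<in> unit_disk"
      hence z: "norm z < 1" by simp
      have "k * norm (deriv h z) < 1 * norm (deriv h z)"
        using k h'0[OF z] by (intro mult_strict_right_mono) auto
      hence "(k * norm (deriv h z))\<^sup>2 < (norm (deriv h z))\<^sup>2"
        using k by (intro power_strict_mono) auto
      thus "0 < (norm (wirtinger_z f z))\<^sup>2 - (norm (wirtinger_zbar f z))\<^sup>2"
        by (simp add: wirt[OF z])
    qed
    show "\<exists>\<Omega> f_inv. homeomorphism unit_disk \<Omega> f f_inv"
      by (rule invariance_of_domain_homeomorphism[OF open_ball cont(1) _ f_inj]) auto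
    show "W12_loc unit_disk f"
      by (rule W12_loc_C1[OF open_ball harmonic_sum_dir_deriv(1)[OF open_ball h_hol g_hol f_sum] cont(2)])
    show "\<forall>z\<in>unit_disk. (norm (wirtinger_z f z) + norm (wirtinger_zbar f z)) /
        (norm (wirtinger_z f z) - norm (wirtinger_zbar f z)) \<le> K"
    proof
      fix z :: complex assume "z \<in> unit_disk"
      hence z: "norm z < 1" by simp
      let ?n = "norm (deriv h z)"
      have "(?n + k * ?n) / (?n - k * ?n) = (?n * (1 + k)) / (?n * (1 - k))" by (simp add: algebra_simps)
      also have "\<dots> = K" using h'0[OF z] kK by simp
      finally show "(norm (wirtinger_z f z) + norm (wirtinger_zbar f z)) /
        (norm (wirtinger_z f z) - norm (wirtinger_zbar f z)) \<le> K" by (simp add: wirt[OF z])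
    qed
  qed

  have tail: "(\<lambda>n. a (Suc n) * z ^ Suc n) sums (h z + ?t)" if "norm z < 1" for z
  proof -
    have "(\<lambda>n. (?t * z) ^ n) sums (1 / (1 - ?t * z))"
      using norm_mult_less[OF nt that] by (intro geometric_sums) simp
    from sums_mult[OF this, of "of_real (1 - t\<^sup>2) * z"]
    have "(\<lambda>n. a (Suc n) * z ^ Suc n) sums (of_real (1 - t\<^sup>2) * z * (1 / (1 - ?t * z)))"
      by (simp add: a_def power_mult_distrib mult_ac)
    also have "of_real (1 - t\<^sup>2) * z * (1 / (1 - ?t * z)) = h z + ?t"
      using nz[OF that] by (simp add: h_eq field_simps power2_eq_square)
    finally show ?thesis .
  qed
  have rep: "canonical_representation f h g a b"
    unfolding canonical_representation_def
  proof (intro conjI ballI)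
    show "h holomorphic_on unit_disk" "g holomorphic_on unit_disk" by fact+
    show "g 0 = 0" by (simp add: g_def h_eq)
    fix z :: complex assume "z \<in> unit_disk"
    hence z: "norm z < 1" by simp
    show "f z = h z + cnj (g z)" by (simp add: f_def)
    show "(\<lambda>n. a n * z ^ n) sums h z"
      using sums_Suc[OF tail[OF z]] by (simp add: a_def)
    show "(\<lambda>n. b (Suc n) * z ^ Suc n) sums g z"
      using sums_mult[OF tail[OF z], of "of_real k"] by (simp add: b_def g_def mult_ac)
  qed

  have h_lt: "norm (h z) < 1" if "norm z < 1" for z
    unfolding h_def by (rule Moebius_function_norm_lt_1[OF nt that])
  have sup: "sup_norm h = 1"
    unfolding sup_norm_def
  proof (rule cSup_eq_non_empty)
    fix y assume y: "\<And>x. x \<in> (\<lambda>z. norm (h z)) ` unit_disk \<Longrightarrow> x \<le> y"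
    show "1 \<le> y"
    proof (rule dense_le_bounded[of 0])
      fix s :: real assume s: "0 < s" "s < 1"
      let ?z = "Moebius_function 0 (- ?t) (of_real s)"
      have "norm ?z < 1" by (rule Moebius_function_norm_lt_1) (use nt s in auto)
      moreover have "h ?z = of_real s"
        unfolding h_def by (rule Moebius_function_compose) (use nt s in auto)
      ultimately show "s \<le> y" using y[of s] s by (force simp: image_iff)
    qed simp
  qed (use h_lt in \<open>auto intro: less_imp_le\<close>)

  have tr: "0 < t * r" "t * r < 1" using t0 t1 r0 r(2) mult_strict_mono[of t 1 r 1] by auto
  have "(\<lambda>n. (1 + k) * (1 - t\<^sup>2) * r * (t * r) ^ n) sums ((1 + k) * (1 - t\<^sup>2) * r * (1 / (1 - t * r)))"
    using tr by (intro sums_mult geometric_sums) simp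
  moreover have "bohr_terms a b r = (\<lambda>n. (1 + k) * (1 - t\<^sup>2) * r * (t * r) ^ n)"
    by (rule ext, use k t0 t2 in \<open>simp add: bohr_terms_def a_def b_def norm_mult norm_power power_mult_distrib
      algebra_simps del: of_real_mult of_real_diff of_real_power\<close>)
  ultimately have bs: "bohr_terms a b r sums ((1 + k) * (1 - t\<^sup>2) * r * (1 / (1 - t * r)))" by simp
  have "1 < (1 + k) * r / (1 - t * r)"
    using t tr r0 by (simp add: field_simps)
  hence "(1 - t\<^sup>2) * 1 < (1 - t\<^sup>2) * ((1 + k) * r / (1 - t * r))"
    using t2 by (intro mult_strict_left_mono) auto
  hence "1 < t\<^sup>2 + (1 + k) * (1 - t\<^sup>2) * r * (1 / (1 - t * r))" by (simp add: mult_ac)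
  hence "bohr_sum a b r > sup_norm h"
    using bs by (simp add: bohr_sum_def sums_iff a_def sup)
  moreover have "bounded (h ` unit_disk)"
    using h_lt by (auto simp: bounded_iff intro!: exI[of _ 1] less_imp_le)
  ultimately show ?thesis using qc rep sup bs sums_summable by blast
qed

section \<open>The sharp Bohr radius\<close>

theorem theorem2:
  fixes K :: real
  assumes "K \<ge> 1"
  shows
    "(\<forall>f h g a b.
        quasiconformal_harmonic K f \<and> canonical_representation f h g a b \<and>
        bounded (h ` unit_disk) \<and> sup_norm h \<le> 1 \<longrightarrow>
        (\<forall>r. 0 \<le> r \<and> r \<le> (K + 1) / (3 * K + 1) \<longrightarrow>
           summable (bohr_terms a b r) \<and> bohr_sum a b r \<le> sup_norm h))
     \<and>
     (\<forall>r. (K + 1) / (3 * K + 1) < r \<and> r < 1 \<longrightarrow>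
        (\<exists>f h g a b.
           quasiconformal_harmonic K f \<and> canonical_representation f h g a b \<and>
           bounded (h ` unit_disk) \<and> sup_norm h = 1 \<and>
           summable (bohr_terms a b r) \<and> bohr_sum a b r > sup_norm h))"
proof (intro conjI allI impI; (elim conjE)?)
  fix f h g a b r
  assume *: "quasiconformal_harmonic K f" "canonical_representation f h g a b"
    "bounded (h ` unit_disk)" "sup_norm h \<le> 1" "0 \<le> r" "r \<le> (K + 1) / (3 * K + 1)"
  show "summable (bohr_terms a b r)" "bohr_sum a b r \<le> sup_norm h"
    by (rule bohr_sum_le_sup_norm[OF assms *])+
qed (rule bohr_sum_sharp[OF assms])

end
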